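(* Let $n\in\{0,1,2,\dots\}$, let $\mu\in\mathbb{C}$ with $\operatorname{Re}(\mu)>-\frac12$, and let $b\in\left(\frac{1}{\sqrt2},1\right)$. Then $$\int_{E_4} \left(\cos\phi_{E_4}(x)\right)^{2n+1}\left(1-\cos^2\phi_{E_4}(x)\right)^{\mu} w_{E_4}(x)\,dx = \left(1-2b\sqrt{1-b^2}\right)\frac{(1)_n}{(\mu+\frac12)_{n+1}}\;{}_2F_1\!\left(\tfrac12,\ \mu+\tfrac12;\ \mu+n+\tfrac32;\ 4b^2(1-b^2)\right).$$
   Context: For $b\in[\frac1{\sqrt2},1)$ put $$E_4:=[-1,-b]\cup[-\sqrt{1-b^2},\sqrt{1-b^2}]\cup[b,1].$$ For (almost every) $x\in E_4$ define $$\cos\phi_{E_4}(x):=\sqrt{\frac{(x-\sqrt{1-b^2})(x+b)}{(x+\sqrt{1-b^2})(x-b)}}\;\cdot\;\frac{(x-b)(x+\sqrt{1-b^2})}{b\sqrt{1-b^2}},$$ $$w_{E_4}(x):=\sqrt{\frac{(x-\sqrt{1-b^2})(x+b)}{(1-x^2)(x-b)(x+\sqrt{1-b^2})}}.$$ Here $\cos\phi_{E_4}$ is just the name of a real-valued function, $\cos^2\phi_{E_4}(x)$ means $(\cos\phi_{E_4}(x))^2$, and square roots of nonnegative reals are nonnegative. For $t>0$, $t^\mu=e^{\mu\log t}$ with the real logarithm. The shifted factorial is $(a)_0:=1$, $(a)_n:=a(a+1)\cdots(a+n-1)$, and ${}_2F_1(\alpha,\beta;\gamma;z)=\sum_{k\ge0}\frac{(\alpha)_k(\beta)_k}{(\gamma)_k\,k!}z^k$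 is the Gauss hypergeometric function (note $0<4b^2(1-b^2)<1$ here). *)

theory Defs
  imports "HOL-Analysis.Analysis"
begin

definition E4 :: "real \<Rightarrow> real set" where
  "E4 b = {-1..-b} \<union> {-sqrt (1 - b\<^sup>2)..sqrt (1 - b\<^sup>2)} \<union> {b..1}"

text \<open>
  For \<open>1/sqrt 2 < b < 1\<close> the radicands below are nonnegative on \<open>E4 b\<close>, except that at
  finitely many points (\<open>b\<close>, \<open>-sqrt (1 - b\<^sup>2)\<close>, \<open>1\<close>, \<open>-1\<close>) a denominator vanishes and the
  quotient takes the value \<open>0\<close> by convention; this null set does not affect integrals.
\<close>

definition cos_phi :: "real \<Rightarrow> real \<Rightarrow> real" where
  "cos_phi b x =
     sqrt (((x - sqrt (1 - b\<^sup>2)) * (x + b)) / ((x + sqrt (1 - b\<^sup>2)) * (x - b)))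
     * (((x - b) * (x + sqrt (1 - b\<^sup>2))) / (b * sqrt (1 - b\<^sup>2)))"

definition w_E4 :: "real \<Rightarrow> real \<Rightarrow> real" where
  "w_E4 b x =
     sqrt (((x - sqrt (1 - b\<^sup>2)) * (x + b)) /
           ((1 - x\<^sup>2) * (x - b) * (x + sqrt (1 - b\<^sup>2))))"

definition hypergeo_2F1 :: "complex \<Rightarrow> complex \<Rightarrow> complex \<Rightarrow> complex \<Rightarrow> complex" where
  "hypergeo_2F1 \<alpha> \<beta> \<gamma> z =
     (\<Sum>k. (pochhammer \<alpha> k * pochhammer \<beta> k) / (pochhammer \<gamma> k * fact k) * z ^ k)"

lemma hypergeo_2F1_eq_eval_fps:
  "hypergeo_2F1 \<alpha> \<beta> \<gamma> z = eval_fps (fps_hypergeo [\<alpha>, \<beta>] [\<gamma>] 1) z"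
  by (simp add: hypergeo_2F1_def eval_fps_def)

end

theory Submission
  imports Defs
begin

text \<open>
  Write \<open>s = sqrt (1 - b\<^sup>2)\<close>, so that \<open>0 < s < b\<close> and \<open>b\<^sup>2 + s\<^sup>2 = 1\<close>.  The substitution that evaluates
  the integral is \<open>u = 1 - cos\<^sup>2 \<phi>\<close>: the relation \<open>b\<^sup>2 + s\<^sup>2 = 1\<close> makes
  \<open>b\<^sup>2 s\<^sup>2 - (x\<^sup>2 - s\<^sup>2)(x\<^sup>2 - b\<^sup>2)\<close> collapse to \<open>x\<^sup>2 (1 - x\<^sup>2)\<close>, hence \<open>u = x\<^sup>2 (1 - x\<^sup>2) / (b s)\<^sup>2\<close>.
  Moreover the product \<open>cos \<phi> \<cdot> w\<close> is the algebraic expression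
  \<open>(x - s)(x + b) / (b s sqrt (1 - x\<^sup>2))\<close> on all of \<open>E4\<close>, with no case distinction on signs
  (\<open>cos_phi_squared\<close>, \<open>cos_phi_times_w\<close>).

  The equation \<open>u x = v\<close> is quadratic in \<open>x\<^sup>2\<close> with discriminant \<open>1 - k v\<close>, \<open>k = 4 b\<^sup>2 s\<^sup>2 < 1\<close>.  It has the
  four roots \<open>\<plusminus> sqrt ((1 \<plusminus> sqrt (1 - k v)) / 2)\<close>, and up to finitely many points \<open>E4\<close> is the disjoint
  union of four intervals, each mapped bijectively onto \<open>(0, 1)\<close> by \<open>u\<close>.  Changing variables on each
  of them (\<open>integrand_on_piece\<close>) turns the integral into
  \[ \int_0^1 (1 - v)^n v^{\mu - 1/2} \sum_X \frac{(X - s)(X + b)}{2 \sqrt{1 - k v}} \, dv , \]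
  where \<open>X\<close> runs over the four roots.  The roots come in pairs \<open>\<plusminus>X\<close> and the two values of \<open>X\<^sup>2\<close> have
  sum 1, so the sum over the roots is \<open>(1 - 2 b s) / sqrt (1 - k v)\<close> (\<open>sum_of_densities\<close>).

  What remains is Euler's integral for \<open>2F1\<close> with \<open>\<alpha> = 1/2\<close> and \<open>\<beta> = \<mu> + 1/2\<close>, in the case where
  \<open>\<gamma> - \<beta> - 1 = n\<close> is a natural number (\<open>Euler_integral_2F1\<close>).  It is obtained by expanding the binomial
  \<open>(1 - z t) powr - \<alpha>\<close> and integrating term by term; as \<open>n\<close> is a natural number, the Beta integrals that
  arise are quotients of a factorial and a Pochhammer symbol.
\<close>

section \<open>Euler's integral for the hypergeometric function\<close>

lemma pochhammer_nonzero_right_half_plane: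
  fixes a :: complex
  assumes "Re a > 0"
  shows "pochhammer a n \<noteq> 0"
proof
  assume "pochhammer a n = 0"
  then obtain k where "a = - of_nat k"
    by (auto simp: pochhammer_eq_0_iff)
  with assms show False by simp
qed

text \<open>
  Induction on the exponent of \<open>1 - t\<close>, for all \<open>a\<close> simultaneously: splitting off one factor
  \<open>1 - t\<close> gives the difference of the integrals for \<open>a\<close> and \<open>a + 1\<close>, and
  \<open>(a)\<^sub>n\<^sub>+\<^sub>2\<close> is a common denominator of the two values.
\<close>

lemma Beta_kernel_has_integral:
  fixes a :: complex
  assumes "Re a > 0"
  shows "((\<lambda>t. (1 - complex_of_real t) ^ n * complex_of_real t powr (a - 1))
           has_integral fact n / pochhammer a (Suc n)) {0..1}"
  using assms
proof (induction n arbitrary: a)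
  case 0
  have "((\<lambda>t. complex_of_real t powr (a - 1)) has_integral
          (of_real 1 powr a / a - of_real 0 powr a / a)) {0..1}"
    using 0 by (intro fundamental_theorem_of_calculus_interior)
      (auto intro!: continuous_intros derivative_eq_intros has_vector_derivative_real_field)
  then show ?case by simp
next
  case (Suc n)
  have nz: "pochhammer a (Suc (Suc n)) \<noteq> 0"
    by (rule pochhammer_nonzero_right_half_plane) fact
  have "((\<lambda>t. (1 - complex_of_real t) ^ n * complex_of_real t powr (a - 1)
             - (1 - complex_of_real t) ^ n * complex_of_real t powr (a + 1 - 1))
          has_integral fact n / pochhammer a (Suc n) - fact n / pochhammer (a + 1) (Suc n)) {0..1}"
    using Suc.IH[of a] Suc.IH[of "a + 1"] Suc.prems by (intro has_integral_diff) auto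
  moreover have "fact n / pochhammer a (Suc n) - fact n / pochhammer (a + 1) (Suc n)
      = fact (Suc n) / pochhammer a (Suc (Suc n))"
  proof -
    have 1: "pochhammer a (Suc (Suc n)) = (a + of_nat (Suc n)) * pochhammer a (Suc n)"
      by (rule pochhammer_rec')
    have 2: "pochhammer a (Suc (Suc n)) = a * pochhammer (a + 1) (Suc n)"
      by (rule pochhammer_rec)
    have "fact n / pochhammer a (Suc n) = fact n * (a + of_nat (Suc n)) / pochhammer a (Suc (Suc n))"
      using nz unfolding 1 by simp
    moreover have "fact n / pochhammer (a + 1) (Suc n) = fact n * a / pochhammer a (Suc (Suc n))"
      using nz unfolding 2 by simp
    ultimately show ?thesis
      by (simp add: diff_divide_distrib [symmetric] algebra_simps)
  qed
  moreover have "(1 - complex_of_real t) ^ n * complex_of_real t powr (a - 1)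
             - (1 - complex_of_real t) ^ n * complex_of_real t powr (a + 1 - 1)
           = (1 - complex_of_real t) ^ Suc n * complex_of_real t powr (a - 1)"
    if "t \<in> {0..1}" for t
  proof (cases "t = 0")
    case False
    then have "complex_of_real t powr (a + 1 - 1) = of_real t * complex_of_real t powr (a - 1)"
      by (simp add: powr_diff)
    then show ?thesis by (simp add: algebra_simps)
  qed auto
  ultimately show ?case
    by (metis (no_types, lifting) has_integral_eq)
qed

lemma Beta_kernel_absolutely_integrable:
  fixes a :: complex
  assumes "Re a > 0"
  shows "(\<lambda>t. (1 - complex_of_real t) ^ n * complex_of_real t powr (a - 1))
           absolutely_integrable_on {0..1}"
proof (rule absolutely_integrable_integrable_bound)
  show "norm ((1 - complex_of_real t) ^ n * complex_of_real t powr (a - 1)) \<le> t powr (Re a - 1)"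
    if "t \<in> {0..1}" for t
  proof -
    have "norm (1 - complex_of_real t) = \<bar>1 - t\<bar>"
      by (metis norm_of_real of_real_1 of_real_diff)
    then have "norm (1 - complex_of_real t) ^ n \<le> 1"
      using that by (intro power_le_one) auto
    then show ?thesis
      using that by (auto simp: norm_mult norm_power norm_powr_real_powr
          intro: mult_left_le_one_le)
  qed
  show "(\<lambda>t. t powr (Re a - 1)) integrable_on {0..1}"
    using assms by (intro integrable_on_powr_from_0) auto
qed (use Beta_kernel_has_integral[OF assms] in blast)

text \<open>
  The interchange of sum and integral is justified by absolute convergence: on \<open>[0, 1]\<close> the
  \<open>m\<close>-th term of the expansion is bounded by its coefficient times the integrable Beta kernel, and
  the coefficients of a binomial series are absolutely summable at every \<open>z\<close> of the open unit disc.
\<close>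

lemma Euler_integral_2F1:
  fixes \<alpha> \<beta> z :: complex
  assumes \<beta>: "Re \<beta> > 0" and z: "norm z < 1"
  shows "((\<lambda>t. (1 - complex_of_real t) ^ n * complex_of_real t powr (\<beta> - 1)
                * (1 - z * of_real t) powr (- \<alpha>))
           has_integral fact n / pochhammer \<beta> (Suc n)
             * hypergeo_2F1 \<alpha> \<beta> (\<beta> + of_nat n + 1) z) {0..1}"
proof -
  define M where "M = lebesgue_on {0..1::real}"
  define B where "B = (\<lambda>t. (1 - complex_of_real t) ^ n * complex_of_real t powr (\<beta> - 1))"
  define c where "c = (\<lambda>m. pochhammer \<alpha> m / fact m * z ^ m)"
  define f where "f = (\<lambda>m t. c m * (complex_of_real t ^ m * B t))"
  have B_int: "integrable M B"
    unfolding M_def B_def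
    by (intro absolutely_integrable_imp_integrable Beta_kernel_absolutely_integrable \<beta>) auto
  have c_eq: "c m * of_real t ^ m = ((- \<alpha>) gchoose m) * (- z * of_real t) ^ m" for m t
  proof -
    have "(- z * of_real t) ^ m = (-1) ^ m * (z ^ m * of_real t ^ m)"
      by (simp add: power_minus[of "z * of_real t"] power_mult_distrib)
    then show ?thesis
      by (simp add: c_def gbinomial_pochhammer)
  qed
  have c_sum: "summable (\<lambda>m. norm (c m))"
  proof -
    have "ereal (norm (- z)) < conv_radius (\<lambda>m. (- \<alpha>) gchoose m)"
      using z by (simp add: conv_radius_gchoose)
    from abs_summable_in_conv_radius[OF this] show ?thesis
      using c_eq[of _ 1] by simp
  qed
  have norm_le: "norm (f m t) \<le> norm (c m) * norm (B t)" if "t \<in> {0..1}" for m t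
  proof -
    have "norm (f m t) = norm (c m) * norm (B t) * \<bar>t\<bar> ^ m"
      by (simp add: f_def norm_mult norm_power)
    also have "\<dots> \<le> norm (c m) * norm (B t) * 1"
      using that by (intro mult_left_mono power_le_one) auto
    finally show ?thesis by simp
  qed
  have binom: "(\<lambda>m. f m t) sums (B t * (1 - z * of_real t) powr (- \<alpha>))"
    and abs_sum: "summable (\<lambda>m. norm (f m t))" if "t \<in> {0..1}" for t
  proof -
    have "norm (- z * of_real t) < 1"
      using that z mult_left_le[of t "norm z"] by (auto simp: norm_mult)
    from gen_binomial_complex[OF this, of "- \<alpha>"]
    have "(\<lambda>m. c m * of_real t ^ m) sums (1 - z * of_real t) powr (- \<alpha>)"
      by (simp add: c_eq)
    from sums_mult2[OF this, of "B t"]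
    show "(\<lambda>m. f m t) sums (B t * (1 - z * of_real t) powr (- \<alpha>))"
      by (simp add: f_def mult_ac)
    show "summable (\<lambda>m. norm (f m t))"
      by (rule summable_comparison_test'[OF summable_mult2[OF c_sum]]) (use norm_le[OF that] in auto)
  qed
  have f_has: "(f m has_integral
      c m * (fact n / pochhammer (\<beta> + of_nat m) (Suc n))) {0..1}" for m
  proof -
    have "((\<lambda>t. c m * ((1 - complex_of_real t) ^ n * complex_of_real t powr (\<beta> + of_nat m - 1)))
       has_integral c m * (fact n / pochhammer (\<beta> + of_nat m) (Suc n))) {0..1}"
      using \<beta> by (intro has_integral_mult_right Beta_kernel_has_integral) auto
    moreover have "c m * ((1 - complex_of_real t) ^ n * complex_of_real t powr (\<beta> + of_nat m - 1))
          = f m t" if "t \<in> {0..1}" for t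
    \<comment> \<open>At \<open>t = 0\<close> both sides vanish because \<open>0 powr _ = 0\<close>.\<close>
    proof (cases "t = 0")
      case False
      have "complex_of_real t powr (\<beta> + of_nat m - 1)
           = complex_of_real t powr (of_nat m) * complex_of_real t powr (\<beta> - 1)"
        by (subst powr_add [symmetric]) (simp add: algebra_simps)
      also have "complex_of_real t powr (of_nat m) = of_real t ^ m"
        using False by (simp add: powr_nat')
      finally show ?thesis by (simp add: f_def B_def mult_ac)
    qed (simp add: f_def B_def)
    ultimately show ?thesis by (rule has_integral_eq[rotated])
  qed
  have f_int: "integrable M (f m)" for m
  proof (rule Bochner_Integration.integrable_bound)
    show "integrable M (\<lambda>t. norm (c m) * norm (B t))"
      using B_int by simp
    have "continuous_on {0..1} (\<lambda>t. c m * complex_of_real t ^ m)"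
      by (intro continuous_intros)
    then have "(\<lambda>t. c m * complex_of_real t ^ m) \<in> borel_measurable M"
      unfolding M_def by (intro continuous_imp_measurable_on_sets_lebesgue) auto
    moreover have "B \<in> borel_measurable M"
      using B_int by auto
    ultimately have "(\<lambda>t. c m * complex_of_real t ^ m * B t) \<in> borel_measurable M"
      by measurable
    then show "f m \<in> borel_measurable M"
      by (simp add: f_def mult.assoc)
    show "AE t in M. norm (f m t) \<le> norm (norm (c m) * norm (B t))"
      by (rule AE_I2) (use norm_le in \<open>auto simp: M_def\<close>)
  qed
  have norm_int: "(\<integral>t. norm (f m t) \<partial>M) \<le> norm (c m) * (\<integral>t. norm (B t) \<partial>M)" for m
  proof -
    have "(\<integral>t. norm (f m t) \<partial>M) \<le> (\<integral>t. norm (c m) * norm (B t) \<partial>M)"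
    proof (rule integral_mono)
      show "norm (f m t) \<le> norm (c m) * norm (B t)" if "t \<in> space M" for t
        using that norm_le by (auto simp: M_def)
    qed (use f_int B_int in auto)
    then show ?thesis by simp
  qed
  \<comment> \<open>Termwise integration, then each term is matched with the corresponding term of \<open>2F1\<close>.\<close>
  have "(\<lambda>m. integral\<^sup>L M (f m)) sums (\<integral>t. (\<Sum>m. f m t) \<partial>M)"
    and lim_int: "integrable M (\<lambda>t. \<Sum>m. f m t)"
  proof -
    have AE: "AE t in M. summable (\<lambda>m. norm (f m t))"
      by (rule AE_I2) (use abs_sum in \<open>auto simp: M_def\<close>)
    have sum: "summable (\<lambda>m. \<integral>t. norm (f m t) \<partial>M)"
      by (rule summable_comparison_test'[OF summable_mult2[OF c_sum]]) (use norm_int in auto)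
    show "(\<lambda>m. integral\<^sup>L M (f m)) sums (\<integral>t. (\<Sum>m. f m t) \<partial>M)"
      by (rule sums_integral[OF f_int AE sum])
    show "integrable M (\<lambda>t. \<Sum>m. f m t)"
      by (rule integrable_suminf[OF f_int AE sum])
  qed
  moreover have "integral\<^sup>L M (f m) = c m * (fact n / pochhammer (\<beta> + of_nat m) (Suc n))" for m
    using lebesgue_integral_eq_integral[OF f_int[unfolded M_def]] f_has[of m]
    by (simp add: M_def integral_unique)
  moreover have "c m * (fact n / pochhammer (\<beta> + of_nat m) (Suc n))
      = fact n / pochhammer \<beta> (Suc n)
        * (pochhammer \<alpha> m * pochhammer \<beta> m / (pochhammer (\<beta> + of_nat n + 1) m * fact m) * z ^ m)"
    for m
  proof -
    have nz: "pochhammer (\<beta> + of_nat i) j \<noteq> 0" for i j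
      using \<beta> by (intro pochhammer_nonzero_right_half_plane) simp
    \<comment> \<open>Both sides are \<open>(\<beta>)\<^sub>n\<^sub>+\<^sub>1\<^sub>+\<^sub>m\<close>, split after \<open>n + 1\<close> and after \<open>m\<close> factors.\<close>
    have "pochhammer \<beta> (Suc n) * pochhammer (\<beta> + of_nat n + 1) m
        = pochhammer \<beta> m * pochhammer (\<beta> + of_nat m) (Suc n)"
      using pochhammer_product'[of \<beta> "Suc n" m] pochhammer_product'[of \<beta> m "Suc n"]
      by (simp add: add_ac)
    then show ?thesis
      using nz[of 0 "Suc n"] nz[of 0 m] nz[of "Suc n" m] nz[of m "Suc n"]
      by (simp add: c_def field_simps del: pochhammer_Suc)
  qed
  ultimately have sums: "(\<lambda>m. fact n / pochhammer \<beta> (Suc n)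
        * (pochhammer \<alpha> m * pochhammer \<beta> m / (pochhammer (\<beta> + of_nat n + 1) m * fact m) * z ^ m))
      sums (\<integral>t. (\<Sum>m. f m t) \<partial>M)"
    by (simp del: pochhammer_Suc)
  have nz: "fact n / pochhammer \<beta> (Suc n) \<noteq> 0"
    using pochhammer_nonzero_right_half_plane[OF \<beta>] by (simp del: pochhammer_Suc)
  have "(\<integral>t. (\<Sum>m. f m t) \<partial>M)
      = fact n / pochhammer \<beta> (Suc n) * hypergeo_2F1 \<alpha> \<beta> (\<beta> + of_nat n + 1) z"
    unfolding hypergeo_2F1_def
    by (rule sums_unique2[OF sums sums_mult[OF summable_sums[OF sums_summable[OF sums_mult_D[OF sums nz]]]]])
  then have "((\<lambda>t. \<Sum>m. f m t) has_integral fact n / pochhammer \<beta> (Suc n)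
      * hypergeo_2F1 \<alpha> \<beta> (\<beta> + of_nat n + 1) z) {0..1}"
    using has_integral_integral_lebesgue_on[OF lim_int[unfolded M_def]] by (simp add: M_def)
  then show ?thesis
    by (rule has_integral_eq[rotated]) (use binom in \<open>simp add: sums_iff B_def\<close>)
qed

section \<open>The four-to-one substitution\<close>

lemma of_real_inverse_sqrt:
  assumes "0 < w"
  shows "complex_of_real (1 / sqrt w) = of_real w powr (- (1 / 2))"
proof -
  have "1 / sqrt w = w powr (- (1 / 2))"
    using assms powr_half_sqrt[of w] by (simp only: powr_minus_divide less_imp_le)
  moreover have "complex_of_real w powr of_real (- (1 / 2)) = of_real (w powr (- (1 / 2)))"
    using assms by (intro powr_of_real) simp
  ultimately show ?thesis by (simp only: of_real_minus of_real_divide of_real_1 of_real_numeral)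
qed

text \<open>
  Keeping \<open>s\<close> as a second parameter, tied to \<open>b\<close> only by \<open>b\<^sup>2 + s\<^sup>2 = 1\<close>, makes all algebra below
  polynomial in \<open>b\<close>, \<open>s\<close> and \<open>x\<close>.
\<close>

locale E4_geometry =
  fixes b s :: real
  assumes s_pos: "0 < s" and s_less_b: "s < b" and circle: "b\<^sup>2 + s\<^sup>2 = 1"
begin

definition k :: real where
  "k = (2 * b * s)\<^sup>2"

definition u :: "real \<Rightarrow> real" where
  "u x = x\<^sup>2 * (1 - x\<^sup>2) / (b * s)\<^sup>2"

text \<open>
  The four roots \<open>x\<close> of \<open>u x = v\<close>: \<open>\<sigma>\<close> is the sign of \<open>x\<close>, and \<open>\<tau>\<close> is the sign of \<open>2 x\<^sup>2 - 1\<close>, which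
  distinguishes the outer intervals (\<open>\<tau> = 1\<close>) from the two halves of the middle one (\<open>\<tau> = -1\<close>).
\<close>

definition branch :: "real \<Rightarrow> real \<Rightarrow> real \<Rightarrow> real" where
  "branch \<sigma> \<tau> v = \<sigma> * sqrt ((1 + \<tau> * sqrt (1 - k * v)) / 2)"

text \<open>
  One formula for the four open intervals, so that the four changes of variables can be treated
  at once.  Its shape comes from the discriminant: on \<open>0 < u x < 1\<close> the number \<open>\<bar>2 x\<^sup>2 - 1\<bar>\<close> is the square
  root of \<open>1 - k u\<close> and so exceeds \<open>sqrt (1 - k) = b\<^sup>2 - s\<^sup>2\<close>.  The intervals themselves are identified
  in \<open>piece_1_1\<close> and its companions.
\<close>

definition piece :: "real \<Rightarrow> real \<Rightarrow> real set" where
  "piece \<sigma> \<tau> = {x. 0 < \<sigma> * x \<and> x\<^sup>2 < 1 \<and> b\<^sup>2 - s\<^sup>2 < \<tau> * (2 * x\<^sup>2 - 1)}"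

lemma b_pos: "0 < b" and b_less_1: "b < 1" and s_less_1: "s < 1"
proof -
  show "0 < b" using s_pos s_less_b by simp
  have "b\<^sup>2 < 1\<^sup>2" using circle s_pos by (smt (verit) one_power2 zero_less_power2)
  then show "b < 1" by (rule power2_less_imp_less) simp
  then show "s < 1" using s_less_b by simp
qed

lemma s_squared: "s\<^sup>2 = 1 - b\<^sup>2"
  using circle by simp

lemma s_squared_less: "s\<^sup>2 < b\<^sup>2"
  using s_pos s_less_b by (intro power_strict_mono) auto

lemma s_eq_sqrt: "sqrt (1 - b\<^sup>2) = s"
  using s_pos s_squared by (metis less_eq_real_def real_sqrt_abs abs_of_pos)

lemma one_minus_k: "1 - k = (b\<^sup>2 - s\<^sup>2)\<^sup>2"
  unfolding k_def s_squared power_mult_distrib by (simp add: power2_eq_square algebra_simps)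

lemma k_pos: "0 < k" and k_less_1: "k < 1"
proof -
  show "0 < k" using s_pos b_pos by (simp add: k_def)
  have "0 < (b\<^sup>2 - s\<^sup>2)\<^sup>2" using s_squared_less by simp
  then show "k < 1" using one_minus_k by linarith
qed

text \<open>
  The reason for the choice of \<open>u\<close>: the discriminant of the quadratic for \<open>x\<^sup>2\<close> becomes a perfect
  square when expressed in \<open>x\<close>.
\<close>

lemma discriminant: "1 - k * u x = (2 * x\<^sup>2 - 1)\<^sup>2"
  using s_pos b_pos by (simp add: k_def u_def power_mult_distrib) (simp add: power2_eq_square algebra_simps)

text \<open>
  The roots of \<open>y (1 - y) = b\<^sup>2 s\<^sup>2\<close> are \<open>b\<^sup>2\<close> and \<open>s\<^sup>2\<close>, since these have sum 1.
\<close>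

lemma one_minus_u: "1 - u x = (x\<^sup>2 - s\<^sup>2) * (x\<^sup>2 - b\<^sup>2) / (b * s)\<^sup>2"
proof -
  have "(x\<^sup>2 - s\<^sup>2) * (x\<^sup>2 - b\<^sup>2) = (b * s)\<^sup>2 - x\<^sup>2 * (1 - x\<^sup>2)"
    unfolding s_squared power_mult_distrib by (simp add: power2_eq_square algebra_simps)
  then show ?thesis
    using s_pos b_pos by (simp add: u_def diff_divide_distrib)
qed

lemma one_minus_kv_pos:
  assumes "0 \<le> v" "v \<le> 1"
  shows "0 < 1 - k * v"
  using mult_left_mono[of v 1 k] assms k_pos k_less_1 by linarith

lemma discriminant_root_bounds:
  assumes "0 < v" "v < 1"
  shows "b\<^sup>2 - s\<^sup>2 < sqrt (1 - k * v)" "sqrt (1 - k * v) < 1"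
proof -
  have "k * v < k" using k_pos assms by simp
  then have "sqrt ((b\<^sup>2 - s\<^sup>2)\<^sup>2) < sqrt (1 - k * v)"
    using one_minus_k by (intro real_sqrt_less_mono) linarith
  then show "b\<^sup>2 - s\<^sup>2 < sqrt (1 - k * v)" using s_squared_less by simp
  show "sqrt (1 - k * v) < 1" using k_pos assms by simp
qed

lemma u_bounds:
  assumes "x \<in> piece \<sigma> \<tau>" "\<tau> \<in> {1, -1}"
  shows "0 < u x" "u x < 1"
proof -
  from assms have x: "x \<noteq> 0" "x\<^sup>2 < 1" and d: "b\<^sup>2 - s\<^sup>2 < \<bar>2 * x\<^sup>2 - 1\<bar>"
    by (auto simp: piece_def)
  show "0 < u x" using x s_pos b_pos by (simp add: u_def)
  have "(b\<^sup>2 - s\<^sup>2)\<^sup>2 < (2 * x\<^sup>2 - 1)\<^sup>2"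
    using d s_squared_less abs_le_square_iff[of "2 * x\<^sup>2 - 1" "b\<^sup>2 - s\<^sup>2"] by linarith
  then have "k * u x < k * 1"
    using discriminant[of x] one_minus_k by linarith
  then show "u x < 1" using k_pos by (simp only: mult_less_cancel_left_pos)
qed

lemma sqrt_discriminant:
  assumes "x \<in> piece \<sigma> \<tau>" "\<tau> \<in> {1, -1}"
  shows "sqrt (1 - k * u x) = \<tau> * (2 * x\<^sup>2 - 1)"
  using assms s_squared_less unfolding discriminant by (auto simp: piece_def)

lemma branch_u:
  assumes "x \<in> piece \<sigma> \<tau>" "\<sigma> \<in> {1, -1}" "\<tau> \<in> {1, -1}"
  shows "branch \<sigma> \<tau> (u x) = x"
proof -
  have "branch \<sigma> \<tau> (u x) = \<sigma> * sqrt (x\<^sup>2)"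
    unfolding branch_def sqrt_discriminant[OF assms(1,3)] using assms(3) by auto
  then show ?thesis using assms(1,2) by (auto simp: piece_def)
qed

lemma branch_squared:
  assumes "0 < v" "v < 1" "\<sigma> \<in> {1, -1}" "\<tau> \<in> {1, -1}"
  shows "(branch \<sigma> \<tau> v)\<^sup>2 = (1 + \<tau> * sqrt (1 - k * v)) / 2"
  using assms discriminant_root_bounds[OF assms(1,2)] s_squared_less
  by (auto simp: branch_def power_mult_distrib)

lemma branch_in_piece:
  assumes "0 < v" "v < 1" "\<sigma> \<in> {1, -1}" "\<tau> \<in> {1, -1}"
  shows "branch \<sigma> \<tau> v \<in> piece \<sigma> \<tau>"
  using assms discriminant_root_bounds[OF assms(1,2)] s_squared_less branch_squared[OF assms]
  by (auto simp: piece_def) (auto simp: branch_def)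

lemma u_branch:
  assumes "0 < v" "v < 1" "\<sigma> \<in> {1, -1}" "\<tau> \<in> {1, -1}"
  shows "u (branch \<sigma> \<tau> v) = v"
proof -
  have "2 * (branch \<sigma> \<tau> v)\<^sup>2 - 1 = \<tau> * sqrt (1 - k * v)"
    unfolding branch_squared[OF assms] by (simp add: field_simps)
  then have "1 - k * u (branch \<sigma> \<tau> v) = (\<tau> * sqrt (1 - k * v))\<^sup>2"
    by (simp add: discriminant)
  also have "\<dots> = 1 - k * v"
    using assms one_minus_kv_pos[of v] by (auto simp: power_mult_distrib)
  finally show ?thesis using k_pos by simp
qed

lemma u_image_piece:
  assumes "\<sigma> \<in> {1, -1}" "\<tau> \<in> {1, -1}"
  shows "u ` piece \<sigma> \<tau> = {0<..<1}"
proof (intro equalityI subsetI)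
  fix v :: real assume "v \<in> {0<..<1}"
  then show "v \<in> u ` piece \<sigma> \<tau>"
    using u_branch[of v, OF _ _ assms] branch_in_piece[of v, OF _ _ assms]
    by (metis greaterThanLessThan_iff image_eqI)
qed (use u_bounds assms(2) in auto)

lemma u_has_derivative:
  "(u has_real_derivative 2 * x * (1 - 2 * x\<^sup>2) / (b * s)\<^sup>2) (at x within S)"
  unfolding u_def using s_pos b_pos
  by (auto intro!: derivative_eq_intros simp: power2_eq_square field_simps)

lemma open_piece: "open (piece \<sigma> \<tau>)"
  unfolding piece_def by (intro open_Collect_conj open_Collect_less continuous_intros)

lemma piece_1_1: "piece 1 1 = {b<..<1}" 
  and piece_m1_1: "piece (-1) 1 = {-1<..<-b}"
  and piece_1_m1: "piece 1 (-1) = {0<..<s}"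
  and piece_m1_m1: "piece (-1) (-1) = {-s<..<0}"
proof -
  have *: "x\<^sup>2 < 1 \<longleftrightarrow> \<bar>x\<bar> < 1" "b\<^sup>2 < x\<^sup>2 \<longleftrightarrow> b < \<bar>x\<bar>" "x\<^sup>2 < s\<^sup>2 \<longleftrightarrow> \<bar>x\<bar> < s" for x
    using abs_square_less_1[of x] abs_le_square_iff[of x b] abs_le_square_iff[of s x] b_pos s_pos
    by auto
  have 1: "b\<^sup>2 - s\<^sup>2 < 1 * (2 * x\<^sup>2 - 1) \<longleftrightarrow> b < \<bar>x\<bar>"
    and 2: "b\<^sup>2 - s\<^sup>2 < -1 * (2 * x\<^sup>2 - 1) \<longleftrightarrow> \<bar>x\<bar> < s" for x
    using *(2,3)[of x] circle by auto
  show "piece 1 1 = {b<..<1}" "piece (-1) 1 = {-1<..<-b}"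
    "piece 1 (-1) = {0<..<s}" "piece (-1) (-1) = {-s<..<0}"
    unfolding piece_def 1 2 *(1) using b_pos s_pos b_less_1 s_less_1 by auto
qed

text \<open>
  With \<open>A = (x - s)(x + b)\<close> and \<open>B = (x + s)(x - b)\<close>, both functions contain the square root of
  \<open>A / B\<close>, and it is squared in either product.  Since \<open>1 - u\<close> is a positive multiple of \<open>A B\<close>, the
  hypothesis says exactly that \<open>A\<close> and \<open>B\<close> are nonzero of equal sign, whichever it is.
\<close>

lemma
  assumes "u x < 1"
  shows cos_phi_squared: "(cos_phi b x)\<^sup>2 = 1 - u x"
    and cos_phi_times_w: "cos_phi b x * w_E4 b x = (x - s) * (x + b) / (b * s * sqrt (1 - x\<^sup>2))"
proof -
  define A where "A = (x - s) * (x + b)"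
  define B where "B = (x + s) * (x - b)"
  have AB: "A * B = (x\<^sup>2 - s\<^sup>2) * (x\<^sup>2 - b\<^sup>2)"
    by (simp add: A_def B_def power2_eq_square algebra_simps)
  have "0 < (x\<^sup>2 - s\<^sup>2) * (x\<^sup>2 - b\<^sup>2) / (b * s)\<^sup>2"
    using assms one_minus_u[of x] by simp
  then have "0 < A * B"
    using s_pos b_pos by (simp add: AB zero_less_divide_iff)
  then have pos: "0 < A / B" and B: "B \<noteq> 0"
    by (auto simp: zero_less_mult_iff zero_less_divide_iff)
  define q where "q = sqrt (A / B)"
  have q: "q * q = A / B"
    unfolding q_def by (subst real_sqrt_mult_self) (rule abs_of_pos[OF pos])
  have cos: "cos_phi b x = q * (B / (b * s))"
    by (simp add: cos_phi_def s_eq_sqrt A_def B_def q_def mult_ac)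
  have w: "w_E4 b x = q / sqrt (1 - x\<^sup>2)"
    by (simp add: w_E4_def s_eq_sqrt A_def B_def q_def mult_ac flip: real_sqrt_divide)
  have "(cos_phi b x)\<^sup>2 = (q * q) * B\<^sup>2 / (b * s)\<^sup>2"
    by (simp add: cos power2_eq_square)
  also have "\<dots> = A * B / (b * s)\<^sup>2"
    unfolding q using B by (simp add: power2_eq_square)
  finally show "(cos_phi b x)\<^sup>2 = 1 - u x"
    by (simp add: AB one_minus_u)
  have "cos_phi b x * w_E4 b x = (q * q) * B / (b * s * sqrt (1 - x\<^sup>2))"
    by (simp add: cos w)
  also have "\<dots> = A / (b * s * sqrt (1 - x\<^sup>2))"
    unfolding q using B by simp
  finally show "cos_phi b x * w_E4 b x = (x - s) * (x + b) / (b * s * sqrt (1 - x\<^sup>2))"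
    by (simp add: A_def)
qed

section \<open>Change of variables on one piece\<close>

definition integrand :: "nat \<Rightarrow> complex \<Rightarrow> real \<Rightarrow> complex" where
  "integrand n \<mu> x = complex_of_real (cos_phi b x) ^ (2 * n + 1)
     * complex_of_real (1 - (cos_phi b x)\<^sup>2) powr \<mu> * complex_of_real (w_E4 b x)"

text \<open>
  The part of the transformed integrand that depends on the branch.  The square root is the factor
  \<open>\<bar>2 x\<^sup>2 - 1\<bar>\<close> of the Jacobian; the other factor \<open>\<bar>x\<bar>\<close> is absorbed by the Beta kernel with parameter
  \<open>\<mu> + 1/2\<close> that \<open>pullback\<close> multiplies the density with.
\<close>

definition density :: "real \<Rightarrow> real \<Rightarrow> real \<Rightarrow> real" where
  "density \<sigma> \<tau> v = (branch \<sigma> \<tau> v - s) * (branch \<sigma> \<tau> v + b) / (2 * sqrt (1 - k * v))"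

definition pullback :: "nat \<Rightarrow> complex \<Rightarrow> real \<Rightarrow> real \<Rightarrow> real \<Rightarrow> complex" where
  "pullback n \<mu> \<sigma> \<tau> v = density \<sigma> \<tau> v *\<^sub>R
     ((1 - complex_of_real v) ^ n * complex_of_real v powr (\<mu> + 1 / 2 - 1))"

text \<open>
  The odd power of \<open>cos \<phi>\<close> is \<open>(1 - u)\<^sup>n cos \<phi>\<close>, whose last factor pairs with \<open>w\<close>.  The Jacobian contributes
  \<open>\<bar>x\<bar>\<close>, and dividing by it turns \<open>1 / sqrt (1 - x\<^sup>2)\<close> into a multiple of \<open>1 / sqrt u\<close>, which lowers the
  exponent of \<open>u\<close> from \<open>\<mu>\<close> to \<open>\<mu> - 1/2\<close>.
\<close>

lemma integrand_eq:
  assumes x: "x \<in> piece \<sigma> \<tau>" and "\<sigma> \<in> {1, -1}" "\<tau> \<in> {1, -1}"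
  shows "integrand n \<mu> x = \<bar>2 * x * (1 - 2 * x\<^sup>2) / (b * s)\<^sup>2\<bar> *\<^sub>R pullback n \<mu> \<sigma> \<tau> (u x)"
proof -
  note bounds = u_bounds[OF x assms(3)]
  define A where "A = (x - s) * (x + b)"
  define r where "r = \<bar>2 * x\<^sup>2 - 1\<bar>"
  have x1: "0 < 1 - x\<^sup>2" "x \<noteq> 0" and r: "0 < r"
    using x assms s_squared_less by (auto simp: piece_def r_def)
  have sqrt_u: "sqrt (u x) = \<bar>x\<bar> * sqrt (1 - x\<^sup>2) / (b * s)"
    using s_pos b_pos by (simp add: u_def real_sqrt_divide real_sqrt_mult)
  have powr_half: "complex_of_real (u x) powr \<mu>
      = of_real (sqrt (u x)) * complex_of_real (u x) powr (\<mu> + 1 / 2 - 1)"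
  proof -
    have "complex_of_real (sqrt (u x)) = of_real (u x powr (1 / 2))"
      using bounds by (simp add: powr_half_sqrt)
    also have "\<dots> = complex_of_real (u x) powr (1 / 2)"
      using bounds by (subst powr_of_real [symmetric]) auto
    finally show ?thesis
      by (simp add: flip: powr_add)
  qed
  have "integrand n \<mu> x = complex_of_real ((cos_phi b x)\<^sup>2) ^ n
      * complex_of_real (cos_phi b x * w_E4 b x) * complex_of_real (1 - (cos_phi b x)\<^sup>2) powr \<mu>"
    by (simp add: integrand_def power_mult)
  also have "\<dots> = complex_of_real (A / (b * s * sqrt (1 - x\<^sup>2)) * sqrt (u x))
       * ((1 - complex_of_real (u x)) ^ n * complex_of_real (u x) powr (\<mu> + 1 / 2 - 1))"
    unfolding cos_phi_squared[OF bounds(2)] cos_phi_times_w[OF bounds(2)] A_def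
    by (simp add: powr_half mult_ac)
  also have "A / (b * s * sqrt (1 - x\<^sup>2)) * sqrt (u x) = \<bar>x\<bar> * A / (b * s)\<^sup>2"
    using x1 s_pos b_pos by (simp add: sqrt_u power2_eq_square)
  also have "\<bar>x\<bar> * A / (b * s)\<^sup>2
      = \<bar>2 * x * (1 - 2 * x\<^sup>2) / (b * s)\<^sup>2\<bar> * density \<sigma> \<tau> (u x)"
  proof -
    have dens: "density \<sigma> \<tau> (u x) = A / (2 * r)"
      unfolding density_def branch_u[OF assms] discriminant A_def r_def by simp
    have jacobian: "\<bar>2 * x * (1 - 2 * x\<^sup>2) / (b * s)\<^sup>2\<bar> = 2 * \<bar>x\<bar> * r / (b * s)\<^sup>2"
      by (simp add: abs_mult r_def abs_minus_commute)
    show ?thesis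
      unfolding dens jacobian using r by simp
  qed
  finally show ?thesis
    by (simp add: pullback_def scaleR_conv_of_real)
qed

text \<open>
  Because \<open>k < 1\<close>, the density is continuous on the closed interval and therefore bounded there.
\<close>

lemma pullback_absolutely_integrable:
  assumes "Re \<mu> > - 1 / 2"
  shows "pullback n \<mu> \<sigma> \<tau> absolutely_integrable_on {0<..<1}"
proof -
  have nz: "sqrt (1 - k * v) \<noteq> 0" if "v \<in> {0..1}" for v
    using one_minus_kv_pos[of v] that by auto
  have cont: "continuous_on {0..1} (density \<sigma> \<tau>)"
    unfolding density_def branch_def by (intro continuous_intros) (use nz in auto)
  have "bounded (density \<sigma> \<tau> ` {0..1})"
    by (intro compact_imp_bounded compact_continuous_image cont) simp
  moreover have "density \<sigma> \<tau> \<in> borel_measurable (lebesgue_on {0..1})"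
    by (intro continuous_imp_measurable_on_sets_lebesgue cont) simp
  ultimately have "pullback n \<mu> \<sigma> \<tau> absolutely_integrable_on {0..1}"
    unfolding pullback_def using assms
    by (intro absolutely_integrable_bounded_measurable_product[where h = scaleR]
          Beta_kernel_absolutely_integrable)
       (auto simp: bilinear_conv_bounded_bilinear bounded_bilinear_scaleR)
  then show ?thesis
    by (rule set_integrable_subset) auto
qed

lemma integrand_on_piece:
  assumes "Re \<mu> > - 1 / 2" "\<sigma> \<in> {1, -1}" "\<tau> \<in> {1, -1}"
  shows "integrand n \<mu> absolutely_integrable_on piece \<sigma> \<tau>"
    and "integral (piece \<sigma> \<tau>) (integrand n \<mu>) = integral {0<..<1} (pullback n \<mu> \<sigma> \<tau>)"
proof -
  let ?h = "\<lambda>x. 2 * x * (1 - 2 * x\<^sup>2) / (b * s)\<^sup>2"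
  let ?g = "\<lambda>x. \<bar>?h x\<bar> *\<^sub>R pullback n \<mu> \<sigma> \<tau> (u x)"
  have "inj_on u (piece \<sigma> \<tau>)"
    by (rule inj_on_inverseI[where g = "branch \<sigma> \<tau>"]) (use branch_u assms in auto)
  then have *: "?g absolutely_integrable_on piece \<sigma> \<tau> \<and>
      integral (piece \<sigma> \<tau>) ?g = integral {0<..<1} (pullback n \<mu> \<sigma> \<tau>)"
    using has_absolute_integral_change_of_variables_real[of "piece \<sigma> \<tau>" u ?h "pullback n \<mu> \<sigma> \<tau>"]
      open_piece u_has_derivative u_image_piece assms pullback_absolutely_integrable
    by (simp add: lebesgue_openin)
  have eq: "integrand n \<mu> x = ?g x" if "x \<in> piece \<sigma> \<tau>" for x
    using integrand_eq[OF that assms(2,3)] .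
  show "integrand n \<mu> absolutely_integrable_on piece \<sigma> \<tau>"
    by (rule absolutely_integrable_spike[OF conjunct1[OF *], of "{}"]) (use eq in auto)
  show "integral (piece \<sigma> \<tau>) (integrand n \<mu>) = integral {0<..<1} (pullback n \<mu> \<sigma> \<tau>)"
    by (rule trans[OF integral_cong conjunct2[OF *]]) (rule eq)
qed

text \<open>
  The four roots are \<open>\<plusminus>p\<close> and \<open>\<plusminus>q\<close> with \<open>p\<^sup>2 + q\<^sup>2 = 1\<close>.  The linear terms of \<open>(X - s)(X + b)\<close> cancel
  within each pair, and the quadratic ones add up to 2.
\<close>

lemma sum_of_densities:
  assumes "0 < v" "v < 1"
  shows "density 1 1 v + density (-1) 1 v + density 1 (-1) v + density (-1) (-1) v
    = (1 - 2 * b * s) / sqrt (1 - k * v)"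
proof -
  define r where "r = sqrt (1 - k * v)"
  define p where "p = sqrt ((1 + r) / 2)"
  define q where "q = sqrt ((1 - r) / 2)"
  have r: "0 < r" "r < 1"
    using one_minus_kv_pos[of v] discriminant_root_bounds(2)[OF assms] assms by (auto simp: r_def)
  then have pq: "p * p + q * q = 1"
    by (simp add: p_def q_def field_simps)
  have "density 1 1 v + density (-1) 1 v + density 1 (-1) v + density (-1) (-1) v
     = ((p - s) * (p + b) + (- p - s) * (- p + b) + (q - s) * (q + b) + (- q - s) * (- q + b)) / (2 * r)"
    by (simp add: density_def branch_def r_def p_def q_def add_divide_distrib)
  also have "(p - s) * (p + b) + (- p - s) * (- p + b) + (q - s) * (q + b) + (- q - s) * (- q + b)
      = 2 * (p * p + q * q) - 4 * (b * s)"
    by (simp add: algebra_simps)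
  also have "\<dots> / (2 * r) = (1 - 2 * b * s) / r"
    using r by (simp add: pq field_simps)
  finally show ?thesis by (simp add: r_def)
qed

section \<open>Assembling the four pieces\<close>

lemma E4_eq_pieces:
  "E4 b - {-1, -b, -s, 0, s, b, 1} = piece 1 1 \<union> piece (-1) 1 \<union> piece 1 (-1) \<union> piece (-1) (-1)"
  unfolding E4_def s_eq_sqrt piece_1_1 piece_m1_1 piece_1_m1 piece_m1_m1
  using s_pos s_less_b b_less_1 by auto

lemma integrand_on_E4:
  assumes \<mu>: "Re \<mu> > - 1 / 2"
  shows "integrand n \<mu> absolutely_integrable_on E4 b"
    and "integral (E4 b) (integrand n \<mu>) = of_real (1 - 2 * b * s) *
      (fact n / pochhammer (\<mu> + 1 / 2) (Suc n)
        * hypergeo_2F1 (1 / 2) (\<mu> + 1 / 2) (\<mu> + of_nat n + 3 / 2) (of_real k))"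
proof -
  let ?F = "integrand n \<mu>"
  let ?U = "piece 1 1 \<union> piece (-1) 1 \<union> piece 1 (-1) \<union> piece (-1) (-1)"
  let ?N = "{-1, -b, -s, 0, s, b, 1}"
  have neg: "negligible {x \<in> ?U - E4 b. ?F x \<noteq> 0}" "negligible {x \<in> E4 b - ?U. ?F x \<noteq> 0}"
    by (rule negligible_subset[of ?N]; use E4_eq_pieces in auto)+
  note abs_int = integrand_on_piece(1)[OF \<mu>]
  note hk = set_lebesgue_integral_eq_integral(1)
  have "?F absolutely_integrable_on ?U"
    by (intro absolutely_integrable_Un abs_int) auto
  then show "?F absolutely_integrable_on E4 b"
    by (rule absolutely_integrable_spike_set[OF _ neg])
  have disj: "piece 1 1 \<inter> piece (-1) 1 = {}" "(piece 1 1 \<union> piece (-1) 1) \<inter> piece 1 (-1) = {}"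
    "(piece 1 1 \<union> piece (-1) 1 \<union> piece 1 (-1)) \<inter> piece (-1) (-1) = {}"
    unfolding piece_1_1 piece_m1_1 piece_1_m1 piece_m1_m1
    using s_pos s_less_b b_less_1 by auto
  note abs_int4 = abs_int[of 1 1, simplified] abs_int[of "-1" 1, simplified]
     abs_int[of 1 "-1", simplified] abs_int[of "-1" "-1", simplified]
  have "integral (E4 b) ?F = integral ?U ?F"
    by (rule integral_spike_set[OF neg(2,1)])
  also have "\<dots> = integral (piece 1 1) ?F + integral (piece (-1) 1) ?F
      + integral (piece 1 (-1)) ?F + integral (piece (-1) (-1)) ?F"
    by (subst integral_Un; (intro hk absolutely_integrable_Un abs_int4 | simp only: disj negligible_empty)?)+
  also have "\<dots> = integral {0<..<1} (pullback n \<mu> 1 1) + integral {0<..<1} (pullback n \<mu> (-1) 1)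
      + integral {0<..<1} (pullback n \<mu> 1 (-1)) + integral {0<..<1} (pullback n \<mu> (-1) (-1))"
    by (simp add: integrand_on_piece(2)[OF \<mu>])
  also have "\<dots> = integral {0<..<1} (\<lambda>v. pullback n \<mu> 1 1 v + pullback n \<mu> (-1) 1 v
      + pullback n \<mu> 1 (-1) v + pullback n \<mu> (-1) (-1) v)"
    using hk[OF pullback_absolutely_integrable[OF \<mu>]]
    by (simp add: Henstock_Kurzweil_Integration.integral_add integrable_add)
  also have "\<dots> = integral {0<..<1} (\<lambda>v. of_real (1 - 2 * b * s)
      * ((1 - complex_of_real v) ^ n * complex_of_real v powr (\<mu> + 1 / 2 - 1)
          * (1 - of_real k * of_real v) powr (- (1 / 2))))"
  proof (rule integral_cong)
    fix v :: real assume v: "v \<in> {0<..<1}"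
    define B where "B = (1 - complex_of_real v) ^ n * complex_of_real v powr (\<mu> + 1 / 2 - 1)"
    have kv: "0 < 1 - k * v"
      using v by (intro one_minus_kv_pos) auto
    have root: "complex_of_real (1 / sqrt (1 - k * v))
        = (1 - of_real k * of_real v) powr (- (1 / 2))"
      using of_real_inverse_sqrt[OF kv] by simp
    have "pullback n \<mu> 1 1 v + pullback n \<mu> (-1) 1 v
      + pullback n \<mu> 1 (-1) v + pullback n \<mu> (-1) (-1) v
      = (density 1 1 v + density (-1) 1 v + density 1 (-1) v + density (-1) (-1) v) *\<^sub>R B"
      by (simp add: pullback_def B_def scaleR_add_left)
    also have "\<dots> = of_real (1 - 2 * b * s) * (B * of_real (1 / sqrt (1 - k * v)))"
      using v by (simp add: sum_of_densities scaleR_conv_of_real)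
    finally show "pullback n \<mu> 1 1 v + pullback n \<mu> (-1) 1 v
      + pullback n \<mu> 1 (-1) v + pullback n \<mu> (-1) (-1) v = of_real (1 - 2 * b * s)
      * ((1 - complex_of_real v) ^ n * complex_of_real v powr (\<mu> + 1 / 2 - 1)
          * (1 - of_real k * of_real v) powr (- (1 / 2)))"
      unfolding root B_def .
  qed
  also have "\<dots> = of_real (1 - 2 * b * s) *
      (fact n / pochhammer (\<mu> + 1 / 2) (Suc n)
        * hypergeo_2F1 (1 / 2) (\<mu> + 1 / 2) (\<mu> + 1 / 2 + of_nat n + 1) (of_real k))"
    unfolding integral_open_interval_real [symmetric] using \<mu> k_pos k_less_1
    by (intro integral_unique has_integral_mult_right Euler_integral_2F1) auto
  also have "\<mu> + 1 / 2 + of_nat n + 1 = \<mu> + of_nat n + 3 / 2"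
    by (simp add: field_simps)
  finally show "integral (E4 b) ?F = of_real (1 - 2 * b * s) *
      (fact n / pochhammer (\<mu> + 1 / 2) (Suc n)
        * hypergeo_2F1 (1 / 2) (\<mu> + 1 / 2) (\<mu> + of_nat n + 3 / 2) (of_real k))" .
qed

text \<open>
  The change of variables speaks about Lebesgue measure; Borel measurability is what transfers
  its conclusion to \<open>lborel\<close>.  The function \<open>t \<mapsto> t powr \<mu>\<close> is continuous only for \<open>t > 0\<close>, so it is cut off
  at 0; this changes the integrand at most at the end points of the pieces.
\<close>

lemma integrand_borel_measurable:
  "(\<lambda>x. indicator (E4 b) x *\<^sub>R integrand n \<mu> x) \<in> borel_measurable lborel"
proof -
  define N where "N = {-1, -b, -s, 0, s, b, 1}"
  define p where "p = (\<lambda>t. indicator {0<..} t *\<^sub>R complex_of_real t powr \<mu>)"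
  have [measurable]: "cos_phi b \<in> borel_measurable borel" "w_E4 b \<in> borel_measurable borel"
    unfolding cos_phi_def w_E4_def by measurable
  have [measurable]: "p \<in> borel_measurable borel"
    unfolding p_def
    by (intro borel_measurable_continuous_on_indicator) (auto intro!: continuous_intros)
  have [measurable]: "E4 b \<in> sets borel"
    unfolding E4_def by measurable
  have "(\<lambda>x. indicator (E4 b) x *\<^sub>R (complex_of_real (cos_phi b x) ^ (2 * n + 1)
      * p (1 - (cos_phi b x)\<^sup>2) * complex_of_real (w_E4 b x))) \<in> borel_measurable lborel"
    by measurable
  then show ?thesis
  proof (rule measurable_discrete_difference[where X = N])
    fix x assume "x \<notin> N"
    show "indicator (E4 b) x *\<^sub>R (complex_of_real (cos_phi b x) ^ (2 * n + 1)
      * p (1 - (cos_phi b x)\<^sup>2) * complex_of_real (w_E4 b x))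
      = indicator (E4 b) x *\<^sub>R integrand n \<mu> x"
    proof (cases "x \<in> E4 b")
      case True
      with \<open>x \<notin> N\<close> obtain \<sigma> \<tau> where "x \<in> piece \<sigma> \<tau>" "\<tau> \<in> {1, -1}"
        using E4_eq_pieces unfolding N_def by blast
      note u = u_bounds[OF this]
      show ?thesis
        using u by (simp add: integrand_def p_def cos_phi_squared)
    qed simp
  qed (auto simp: N_def)
qed

end

theorem theorem3p2:
  fixes n :: nat and \<mu> :: complex and b :: real
  assumes "Re \<mu> > - 1 / 2"
    and "b \<in> {1 / sqrt 2 <..< 1}"
  shows "set_integrable lborel (E4 b)
           (\<lambda>x. complex_of_real (cos_phi b x) ^ (2 * n + 1)
                * complex_of_real (1 - (cos_phi b x)\<^sup>2) powr \<mu>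
                * complex_of_real (w_E4 b x))
       \<and> (LINT x:E4 b|lborel.
              complex_of_real (cos_phi b x) ^ (2 * n + 1)
              * complex_of_real (1 - (cos_phi b x)\<^sup>2) powr \<mu>
              * complex_of_real (w_E4 b x))
         = complex_of_real (1 - 2 * b * sqrt (1 - b\<^sup>2))
           * (pochhammer 1 n / pochhammer (\<mu> + 1 / 2) (n + 1))
           * hypergeo_2F1 (1 / 2) (\<mu> + 1 / 2) (\<mu> + of_nat n + 3 / 2)
               (complex_of_real (4 * b\<^sup>2 * (1 - b\<^sup>2)))"
proof -
  have b: "1 / sqrt 2 < b" "b < 1" and b0: "0 < b"
    using assms(2) by (auto intro: order.strict_trans[of 0 "1 / sqrt 2"])
  have "(1 / sqrt 2)\<^sup>2 < b\<^sup>2"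
    using b by (intro power_strict_mono) auto
  then have half: "1 / 2 < b\<^sup>2" by (simp add: power_divide)
  have b2: "b\<^sup>2 < 1" using b b0 by (simp add: abs_square_less_1)
  interpret E4_geometry b "sqrt (1 - b\<^sup>2)"
  proof
    show "0 < sqrt (1 - b\<^sup>2)" using b2 by simp
    show "sqrt (1 - b\<^sup>2) < b" using half b0 by (intro real_less_lsqrt) auto
    show "b\<^sup>2 + (sqrt (1 - b\<^sup>2))\<^sup>2 = 1" using b2 by simp
  qed
  have k_eq: "k = 4 * b\<^sup>2 * (1 - b\<^sup>2)"
    using b2 by (simp add: k_def power_mult_distrib)
  note F_eq = integrand_def[symmetric]
  have int: "set_integrable lborel (E4 b) (integrand n \<mu>)"
    using integrand_on_E4(1)[OF assms(1), of n] integrand_borel_measurable[of n \<mu>]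
    unfolding set_integrable_def by (simp add: integrable_completion)
  have "(LINT x:E4 b|lborel. integrand n \<mu> x) = (LINT x:E4 b|lebesgue. integrand n \<mu> x)"
    unfolding set_lebesgue_integral_def
    by (rule integral_completion[symmetric, OF integrand_borel_measurable])
  also have "\<dots> = integral (E4 b) (integrand n \<mu>)"
    by (rule set_lebesgue_integral_eq_integral(2)[OF integrand_on_E4(1)[OF assms(1)]])
  finally show ?thesis
    unfolding F_eq using int integrand_on_E4(2)[OF assms(1), of n]
    by (simp add: k_eq mult.assoc flip: pochhammer_fact del: pochhammer_Suc)
qed

end
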